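(* Let $(\gamma_n)_{n\ge 1}$ be independent random variables, where $\gamma_n$ is a gamma random variable with parameter $n$. Then for every complex $z$ with $\Re(z)>-1$, $$\lim_{N\to\infty}\frac{1}{N^{z^2/2}}\,\mathbb{E}\left[\exp\left(-z\left(\sum_{n=1}^{N}\frac{\gamma_n}{n}-N\right)\right)\right]=\left(A^{z}\exp\left(\frac{z^2}{2}\right)G(1+z)\right)^{-1},$$ where $A=\sqrt{\dfrac{e}{2\pi}}$ and $G$ is the Barnes G-function.
   Context: A gamma variable $\gamma_a$ with parameter $a>0$ has law $\mathbb{P}(\gamma_a\in dt)=\frac{t^{a-1}e^{-t}}{\Gamma(a)}\,dt$ on $t>0$. The Barnes G-function is defined by $$G(1+z)=(2\pi)^{z/2}\exp\left[-\tfrac12\left((1+\gamma)z^2+z\right)\right]\prod_{n=1}^{\infty}\left(1+\frac{z}{n}\right)^{n}\exp\left[-z+\frac{z^2}{2n}\right],$$ where $\gamma$ (without index) is Euler's constant. Complex powers of positive reals $x$ are $x^{w}=\exp(w\log x)$ with the real logarithm. *)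

theory Defs
  imports "HOL-Probability.Probability"
begin

definition gamma_density :: "real \<Rightarrow> real \<Rightarrow> real" where
  "gamma_density a t = (if t > 0 then t powr (a - 1) * exp (- t) / Gamma a else 0)"

text \<open>The defining product is given for \<open>G (1 + z)\<close>, hence the shift by one.  The product index
  runs over \<open>n \<ge> 1\<close>, rendered as \<open>Suc n\<close>.\<close>

definition barnes_G :: "complex \<Rightarrow> complex" where
  "barnes_G w = (let z = w - 1 in
     complex_of_real (2 * pi) powr (z / 2)
     * exp (- ((1 + euler_mascheroni) * z\<^sup>2 + z) / 2)
     * (\<Prod>n. (1 + z / of_nat (Suc n)) ^ Suc n * exp (- z + z\<^sup>2 / (2 * of_nat (Suc n)))))"

end

theory Submission
  imports Defs "HOL-Real_Asymp.Real_Asymp"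
begin

text \<open>The Laplace transform of a gamma variable gives
  \<open>E exp (- z \<gamma>\<^sub>n / n) = (1 + z / n)\<^sup>-\<^sup>n\<close>, so by independence the expectation equals
  \<open>e\<^sup>z\<^sup>N \<Prod>\<^sub>n (1 + z / n)\<^sup>-\<^sup>n\<close>.  This is \<open>exp (z\<^sup>2 H\<^sub>N / 2)\<close>
  times the inverse of the \<open>N\<close>-th partial Barnes product, where \<open>H\<^sub>N\<close> is the harmonic number,
  and \<open>H\<^sub>N - ln N\<close> tends to Euler's constant.\<close>

section \<open>Convergence of the Barnes product\<close>

text \<open>Beyond degree two, the logarithm series is dominated termwise by the geometric series
  with first term \<open>norm w ^ 3\<close> and ratio \<open>norm w\<close>.\<close>

lemma Ln_approx_quadratic:
  fixes w :: complex
  assumes "norm w < 1"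
  shows "norm (Ln (1 + w) - w + w\<^sup>2 / 2) \<le> norm w ^ 3 / (1 - norm w)"
proof -
  define a where "a = (\<lambda>n. - ((-w) ^ n) / of_nat n :: complex)"
  have "a sums Ln (1 + w)"
    unfolding a_def by (rule Ln_series'[OF assms])
  hence "(\<lambda>n. a (n + 3)) sums (Ln (1 + w) - (\<Sum>i<3. a i))"
    by (rule sums_split_initial_segment)
  \<comment> \<open>The term of index 0 is a division by zero, hence 0, so dropping three terms
    removes exactly degrees 1 and 2.\<close>
  moreover have "(\<Sum>i<3. a i) = w - w\<^sup>2 / 2"
    by (simp add: a_def eval_nat_numeral)
  ultimately have tail: "(\<lambda>n. a (n + 3)) sums (Ln (1 + w) - w + w\<^sup>2 / 2)"
    by (simp add: algebra_simps)
  have geo: "(\<lambda>n. norm w ^ 3 * norm w ^ n) sums (norm w ^ 3 * (1 / (1 - norm w)))"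
    using assms by (intro sums_mult geometric_sums) auto
  have le: "norm (a (n + 3)) \<le> norm w ^ 3 * norm w ^ n" for n
  proof -
    have "norm (a (n + 3)) = norm w ^ (n + 3) / real (n + 3)"
      unfolding a_def norm_divide norm_minus_cancel norm_power norm_of_nat ..
    also have "\<dots> \<le> norm w ^ (n + 3) / 1"
      by (intro divide_left_mono) auto
    also have "\<dots> = norm w ^ 3 * norm w ^ n"
      by (simp add: power_add)
    finally show ?thesis .
  qed
  have "norm (\<Sum>n. a (n + 3)) \<le> (\<Sum>n. norm w ^ 3 * norm w ^ n)"
    by (rule norm_suminf_le) (use geo le sums_summable in blast)+
  thus ?thesis
    using sums_unique[OF tail] sums_unique[OF geo] by simp
qed

text \<open>With \<open>m = Suc n\<close> and \<open>w = z / m\<close>, the summand is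
  \<open>m\<close> times the error of the quadratic approximation of \<open>Ln (1 + w)\<close>. That
  error is of order \<open>1 / m ^ 3\<close>, which leaves a summable
  \<open>1 / m ^ 2\<close>.\<close>

lemma summable_barnes_log:
  fixes z :: complex
  shows "summable (\<lambda>n. of_nat (Suc n) * Ln (1 + z / of_nat (Suc n)) - z + z\<^sup>2 / (2 * of_nat (Suc n)))"
proof (rule summable_comparison_test_ev)
  show "summable (\<lambda>n. 2 * norm z ^ 3 * inverse (real (Suc n) ^ 2))"
    using inverse_squares_sums by (intro summable_mult) (simp add: sums_iff field_simps)
  show "\<forall>\<^sub>F n in sequentially. norm (of_nat (Suc n) * Ln (1 + z / of_nat (Suc n)) - z
      + z\<^sup>2 / (2 * of_nat (Suc n))) \<le> 2 * norm z ^ 3 * inverse (real (Suc n) ^ 2)"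
    \<comment> \<open>Past this threshold \<open>norm w\<close> is at most 1/2, so
      \<open>1 / (1 - norm w)\<close> is at most 2: this is the factor 2 in the majorant.\<close>
    using eventually_ge_at_top[of "nat \<lceil>2 * norm z\<rceil>"]
  proof eventually_elim
    case (elim n)
    define m where "m = real (Suc n)"
    have m: "m > 0" and m2: "2 * norm z \<le> m"
      using elim by (auto simp: m_def)
    define w where "w = z / of_nat (Suc n)"
    have z: "z = of_nat (Suc n) * w" and nw: "norm w = norm z / m"
      by (simp_all add: w_def m_def norm_divide del: of_nat_Suc)
    have w: "norm w \<le> 1 / 2"
      using m m2 by (simp add: nw field_simps)
    have "of_nat (Suc n) * Ln (1 + w) - z + z\<^sup>2 / (2 * of_nat (Suc n))
        = of_nat (Suc n) * (Ln (1 + w) - w + w\<^sup>2 / 2)"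
      by (simp add: z field_simps power2_eq_square del: of_nat_Suc)
    hence "norm (of_nat (Suc n) * Ln (1 + w) - z + z\<^sup>2 / (2 * of_nat (Suc n)))
        = m * norm (Ln (1 + w) - w + w\<^sup>2 / 2)"
      by (simp add: norm_mult m_def del: of_nat_Suc)
    also have "\<dots> \<le> m * (norm w ^ 3 / (1 - norm w))"
      using m w by (intro mult_left_mono Ln_approx_quadratic) auto
    also have "\<dots> \<le> m * (norm w ^ 3 / (1 / 2))"
      using m w by (intro mult_left_mono divide_left_mono) auto
    also have "\<dots> = 2 * norm z ^ 3 * inverse (m ^ 2)"
      using m by (simp add: nw field_simps eval_nat_numeral)
    finally show ?case by (simp add: w_def m_def)
  qed
qed

text \<open>Nonzero factors can be written as exponentials of the summands in
  \<open>summable_barnes_log\<close>, so the product is the exponential of a convergent series. Its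
  nonvanishing later permits dividing by it in the limit.\<close>

lemma barnes_product_nonzero_and_LIMSEQ:
  fixes z :: complex
  assumes "\<And>n. 1 + z / of_nat (Suc n) \<noteq> 0"
  defines "F \<equiv> \<lambda>n. (1 + z / of_nat (Suc n)) ^ Suc n * exp (- z + z\<^sup>2 / (2 * of_nat (Suc n)))"
  shows "prodinf F \<noteq> 0" and "(\<lambda>N. \<Prod>n<N. F n) \<longlonglongrightarrow> prodinf F"
proof -
  define f where
    "f = (\<lambda>n. of_nat (Suc n) * Ln (1 + z / of_nat (Suc n)) - z + z\<^sup>2 / (2 * of_nat (Suc n)))"
  have "F = (\<lambda>n. exp (f n))"
  proof
    fix n
    have "exp (f n) = exp (of_nat (Suc n) * Ln (1 + z / of_nat (Suc n)))
        * exp (- z + z\<^sup>2 / (2 * of_nat (Suc n)))"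
      by (simp add: f_def exp_add [symmetric] algebra_simps del: of_nat_Suc)
    thus "F n = exp (f n)"
      \<comment> \<open>Since \<open>Suc n\<close> is an integer, exponentiating
        \<open>Suc n\<close> times the principal logarithm returns the exact power, whatever the
        argument of the base.\<close>
      using assms(1)[of n] unfolding exp_of_nat_mult F_def by (simp del: of_nat_Suc)
  qed
  moreover have "f sums suminf f"
    using summable_barnes_log unfolding f_def by (rule summable_sums)
  ultimately have F: "F has_prod exp (suminf f)"
    using sums_imp_has_prod_exp[of f "suminf f"] by (simp add: has_prod_def)
  hence "prodinf F = exp (suminf f)"
    by (metis has_prod_unique)
  thus "prodinf F \<noteq> 0" and "(\<lambda>N. \<Prod>n<N. F n) \<longlonglongrightarrow> prodinf F"
    using has_prod_imp_tendsto'[OF F] by auto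
qed

section \<open>The Laplace transform of a gamma variable\<close>

text \<open>For \<open>t > 0\<close> the modulus of the integrand is the Erlang density of rate
  \<open>Re s\<close>, up to the constant \<open>fact k / Re s ^ Suc k\<close>.\<close>

lemma integrable_power_times_exp:
  fixes s :: complex
  assumes "Re s > 0"
  shows "set_integrable lborel {0<..} (\<lambda>t. of_real t ^ k * exp (- s * of_real t))"
proof -
  \<comment> \<open>The total mass is read off as the moment of order 0.\<close>
  have "(\<integral>\<^sup>+ t. ennreal (erlang_density k (Re s) t) \<partial>lborel) = 1"
    using nn_integral_erlang_ith_moment[OF assms, of k 0] by simp
  hence "integrable lborel (erlang_density k (Re s))"
    using assms by (intro integrableI_nonneg) auto
  hence "integrable lborel (\<lambda>t. fact k / Re s ^ Suc k * erlang_density k (Re s) t)"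
    by simp
  thus ?thesis
    unfolding set_integrable_def
    using assms
    by (elim Bochner_Integration.integrable_bound)
       (auto simp: erlang_density_def norm_mult norm_power indicator_def)
qed

text \<open>Induction on \<open>k\<close> through integration by parts. It runs directly with
  complex \<open>s\<close>, so neither a contour rotation nor an analytic continuation from real
  \<open>s\<close> enters.\<close>

lemma integral_power_times_exp:
  fixes s :: complex
  assumes "Re s > 0"
  shows "(LBINT t:{0<..}. of_real t ^ k * exp (- s * of_real t)) = fact k / s ^ Suc k"
proof -
  define I where "I k = (LBINT t:{0<..}. of_real t ^ k * exp (- s * of_real t))" for k
  have s: "s \<noteq> 0" using assms by auto
  \<comment> \<open>Both cases of the induction integrate the derivative of a function that is
    differentiable on the whole line and vanishes at infinity, so only the boundary value at 0
    survives.\<close>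
  have FTC: "(LBINT t:{0<..}. f t) = - F 0"
    if der: "\<And>t. (F has_vector_derivative f t) (at t)" 
      and cont: "continuous_on UNIV f"
      and int: "set_integrable lborel {0<..} f"
      and lim: "(F \<longlongrightarrow> 0) at_top" for f F :: "real \<Rightarrow> complex"
  proof -
    have "(LBINT x=0..\<infinity>. f x) = 0 - F 0"
    proof (rule interval_integral_FTC_integrable[where F = F])
      show "set_integrable lborel (einterval 0 \<infinity>) f"
        using int by (simp add: zero_ereal_def)
      have "(F \<longlongrightarrow> F 0) (at_right 0)"
        using has_vector_derivative_continuous[OF der[of 0]]
        by (simp add: continuous_within filterlim_at_split)
      thus "((F \<circ> real_of_ereal) \<longlongrightarrow> F 0) (at_right 0)"
        unfolding zero_ereal_def by (simp add: ereal_tendsto_simps)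
      show "((F \<circ> real_of_ereal) \<longlongrightarrow> 0) (at_left \<infinity>)"
        using lim by (simp add: ereal_tendsto_simps)
    qed (use der cont in \<open>auto simp: continuous_on_eq_continuous_at\<close>)
    thus ?thesis
      by (simp add: zero_ereal_def interval_integral_to_infinity_eq)
  qed
  have lim: "((\<lambda>t. of_real t ^ k * exp (- s * of_real t)) \<longlongrightarrow> 0) at_top" for k
  proof (rule tendsto_norm_zero_cancel)
    have "((\<lambda>t. t ^ k * exp (- Re s * t)) \<longlongrightarrow> 0) at_top"
      using assms by real_asymp
    moreover have "\<forall>\<^sub>F t in at_top. t ^ k * exp (- Re s * t)
        = norm (of_real t ^ k * exp (- s * of_real t))"
      using eventually_ge_at_top[of 0] by eventually_elim (simp add: norm_mult norm_power)
    ultimately show "((\<lambda>t. norm (of_real t ^ k * exp (- s * of_real t))) \<longlongrightarrow> 0) at_top"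
      by (rule Lim_transform_eventually)
  qed
  note int = integrable_power_times_exp[OF assms]
  have "I k = fact k / s ^ Suc k" for k
  proof (induction k)
    case 0
    \<comment> \<open>The trivial power is kept so that \<open>int\<close> and \<open>lim\<close>
      apply as they stand. It equals 1 also at \<open>t = 0\<close>, which gives the boundary value
      1.\<close>
    let ?F = "\<lambda>t. of_real t ^ 0 * exp (- s * of_real t) :: complex"
    let ?f = "\<lambda>t. - s * ?F t"
    have "(LBINT t:{0<..}. ?f t) = - ?F 0"
    proof (rule FTC)
      show "(?F has_vector_derivative ?f t) (at t)" for t
        by (rule has_vector_derivative_real_field) (auto intro!: derivative_eq_intros)
      show "continuous_on UNIV ?f"
        by (intro continuous_intros)
      show "set_integrable lborel {0<..} ?f"
        by (intro set_integrable_mult_right int)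
    qed (rule lim)
    hence "s * I 0 = 1"
      unfolding I_def set_integral_mult_right by simp
    thus ?case using s by (simp add: field_simps)
  next
    case (Suc k)
    let ?F = "\<lambda>k t. of_real t ^ k * exp (- s * of_real t) :: complex"
    \<comment> \<open>This is the derivative of \<open>?F (Suc k)\<close>. The boundary value of
      \<open>?F (Suc k)\<close> at 0 is now 0, which yields the recurrence between
      \<open>I (Suc k)\<close> and \<open>I k\<close>.\<close>
    let ?f = "\<lambda>t. of_nat (Suc k) * ?F k t - s * ?F (Suc k) t"
    have int': "set_integrable lborel {0<..} (\<lambda>t. of_nat (Suc k) * ?F k t)"
      "set_integrable lborel {0<..} (\<lambda>t. s * ?F (Suc k) t)"
      by (intro set_integrable_mult_right int)+
    have "(LBINT t:{0<..}. ?f t) = - ?F (Suc k) 0"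
    proof (rule FTC)
      show "(?F (Suc k) has_vector_derivative ?f t) (at t)" for t
        by (rule has_vector_derivative_real_field)
           (auto intro!: derivative_eq_intros simp: algebra_simps simp del: power_Suc)
      show "continuous_on UNIV ?f"
        by (intro continuous_intros)
      show "set_integrable lborel {0<..} ?f"
        by (intro set_integral_diff(1) int')
    qed (rule lim)
    moreover have "(LBINT t:{0<..}. ?f t) = of_nat (Suc k) * I k - s * I (Suc k)"
      unfolding I_def set_integral_diff(2)[OF int'] set_integral_mult_right ..
    ultimately have "s * I (Suc k) = of_nat (Suc k) * I k"
      by simp
    thus ?case using s Suc by (simp add: field_simps)
  qed
  thus ?thesis by (simp add: I_def)
qed

text \<open>The exponential tilts the density to \<open>t ^ k * exp (- (1 + w) * t) / fact k\<close>
  with \<open>k = n - 1\<close>, so the preceding integral applies with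
  \<open>s = 1 + w\<close>.\<close>

lemma gamma_laplace:
  fixes X :: "'a \<Rightarrow> real" and w :: complex
  assumes X: "distributed M lborel X (\<lambda>t. ennreal (gamma_density (real n) t))"
    and n: "n \<ge> 1" and w: "Re w > - 1"
  shows "integrable M (\<lambda>\<omega>. exp (- w * of_real (X \<omega>)))"
    and "(\<integral>\<omega>. exp (- w * of_real (X \<omega>)) \<partial>M) = inverse ((1 + w) ^ n)"
proof -
  define k where "k = n - 1"
  have nk: "n = Suc k" using n by (simp add: k_def)
  define g where "g = (\<lambda>t::real. exp (- w * of_real t))"
  have [measurable]: "g \<in> borel_measurable borel"
    unfolding g_def by (intro borel_measurable_continuous_onI continuous_intros)
  have X_meas [measurable]: "X \<in> borel_measurable M"
    using distributed_measurable[OF X] by simp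
  have dens_meas [measurable]: "gamma_density (real n) \<in> borel_measurable borel"
    unfolding gamma_density_def[abs_def] by measurable
  have nonneg: "gamma_density (real n) t \<ge> 0" for t
    using n by (simp add: gamma_density_def Gamma_real_pos less_imp_le)
  have Re: "Re (1 + w) > 0" using w by simp
  \<comment> \<open>The indicator takes over the case distinction on \<open>t > 0\<close> in the
    density, so the identity holds for all \<open>t\<close>.\<close>
  have eq: "gamma_density (real n) t *\<^sub>R g t = (1 / fact k) *\<^sub>R
      (indicator {0<..} t *\<^sub>R (of_real t ^ k * exp (- (1 + w) * of_real t)))" for t
  proof (cases "t > 0")
    case True
    have "Gamma (real n) = fact k"
      using Gamma_fact[of k, where ?'a = real] by (simp add: nk add.commute)
    moreover have "t powr (real n - 1) = t ^ k"
      using True by (simp add: nk powr_realpow)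
    moreover have "exp (- (1 + w) * of_real t) = of_real (exp (- t)) * g t"
      unfolding g_def exp_of_real [symmetric] exp_add [symmetric] by (simp add: algebra_simps)
    ultimately show ?thesis
      using True by (simp add: gamma_density_def scaleR_conv_of_real)
  qed (simp add: gamma_density_def)
  have distr: "distr M lborel X = density lborel (gamma_density (real n))"
    using distributed_distr_eq_density[OF X] by simp
  have "integrable lborel (\<lambda>t. gamma_density (real n) t *\<^sub>R g t)"
    unfolding eq using integrable_power_times_exp[OF Re, of k]
    by (intro integrable_scaleR_right) (simp add: set_integrable_def)
  hence "integrable (distr M lborel X) g"
    unfolding distr using nonneg by (subst integrable_density) auto
  thus "integrable M (\<lambda>\<omega>. exp (- w * of_real (X \<omega>)))"
    by (subst (asm) integrable_distr_eq) (auto simp: g_def)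
  have "(\<integral>\<omega>. g (X \<omega>) \<partial>M) = (\<integral>t. g t \<partial>distr M lborel X)"
    by (subst integral_distr) auto
  also have "\<dots> = (\<integral>t. gamma_density (real n) t *\<^sub>R g t \<partial>lborel)"
    unfolding distr using nonneg by (subst integral_density) auto
  also have "\<dots> = (1 / fact k) *\<^sub>R (LBINT t:{0<..}. of_real t ^ k * exp (- (1 + w) * of_real t))"
    unfolding eq set_lebesgue_integral_def by (rule integral_scaleR_right)
  also have "\<dots> = inverse ((1 + w) ^ n)"
    unfolding integral_power_times_exp[OF Re] by (simp add: nk scaleR_conv_of_real field_simps)
  finally show "(\<integral>\<omega>. exp (- w * of_real (X \<omega>)) \<partial>M) = inverse ((1 + w) ^ n)"
    by (simp add: g_def)
qed

section \<open>The expectation for finite \<open>N\<close>\<close>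

text \<open>This serves twice: the Laplace transform converges at \<open>z / n\<close>, and the
  factors \<open>1 + z / n\<close> do not vanish.\<close>

lemma Re_scaled_gt_minus_one:
  assumes "Re z > - 1" "n \<ge> 1"
  shows "Re (z / of_nat n) > - 1"
proof -
  have "- real n < Re z" using assms by linarith
  thus ?thesis using assms(2) by (simp add: field_simps)
qed

text \<open>The exponential of the sum is a product of continuous images of the \<open>X n\<close>,
  which stay independent and are integrable by \<open>gamma_laplace\<close>. The deterministic
  centering by \<open>N\<close> contributes \<open>exp (z * of_nat N)\<close>.\<close>

lemma expectation_exp_gamma_sum:
  fixes z :: complex and X :: "nat \<Rightarrow> 'a \<Rightarrow> real"
  assumes "prob_space M"
    and indep: "prob_space.indep_vars M (\<lambda>_. borel) X {1..}"
    and X: "\<And>n. n \<ge> 1 \<Longrightarrow> distributed M lborel (X n) (\<lambda>t. ennreal (gamma_density (real n) t))"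
    and z: "Re z > -1"
  shows "prob_space.expectation M
      (\<lambda>\<omega>. exp (- z * complex_of_real ((\<Sum>n=1..N. X n \<omega> / real n) - real N)))
    = exp (z * of_nat N) * (\<Prod>n=1..N. inverse ((1 + z / of_nat n) ^ n))"
proof -
  interpret prob_space M by fact
  define Y where "Y n \<omega> = exp (- (z / of_nat n) * of_real (X n \<omega>))" for n \<omega>
  have Y: "integrable M (Y n)" "expectation (Y n) = inverse ((1 + z / of_nat n) ^ n)"
    if "n \<in> {1..N}" for n
    using gamma_laplace[OF X _ Re_scaled_gt_minus_one[OF z], of n n] that
    by (simp_all add: Y_def[abs_def])
  have "indep_vars (\<lambda>_. borel) Y {1..}"
    unfolding Y_def[abs_def]
    by (rule indep_vars_compose2[OF indep])
       (auto intro!: borel_measurable_continuous_onI continuous_intros)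
  hence "indep_vars (\<lambda>_. borel) Y {1..N}"
    by (rule indep_vars_subset) auto
  hence "expectation (\<lambda>\<omega>. \<Prod>n=1..N. Y n \<omega>) = (\<Prod>n=1..N. expectation (Y n))"
    using Y by (intro indep_vars_lebesgue_integral) auto
  also have "\<dots> = (\<Prod>n=1..N. inverse ((1 + z / of_nat n) ^ n))"
    using Y by (intro prod.cong) auto
  finally have prod: "expectation (\<lambda>\<omega>. \<Prod>n=1..N. Y n \<omega>)
      = (\<Prod>n=1..N. inverse ((1 + z / of_nat n) ^ n))" .
  have "exp (- z * complex_of_real ((\<Sum>n=1..N. X n \<omega> / real n) - real N))
      = exp (z * of_nat N) * (\<Prod>n=1..N. Y n \<omega>)" for \<omega>
    by (simp add: Y_def exp_sum [symmetric] exp_add [symmetric] sum_distrib_left sum_negf algebra_simps)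
  thus ?thesis using prod by simp
qed

section \<open>Passage to the limit\<close>

theorem theorem1p2:
  fixes M :: "'a measure" and X :: "nat \<Rightarrow> 'a \<Rightarrow> real" and z :: complex
  assumes "prob_space M"
    and "prob_space.indep_vars M (\<lambda>_. borel) X {1..}"
    and "\<And>n. n \<ge> 1 \<Longrightarrow> distributed M lborel (X n) (\<lambda>t. ennreal (gamma_density (real n) t))"
    and "Re z > -1"
  shows "(\<lambda>N. 1 / complex_of_nat N powr (z\<^sup>2 / 2)
              * prob_space.expectation M
                  (\<lambda>\<omega>. exp (- z * complex_of_real ((\<Sum>n=1..N. X n \<omega> / real n) - real N))))
         \<longlonglongrightarrow> inverse (complex_of_real (sqrt (exp 1 / (2 * pi))) powr z
                     * exp (z\<^sup>2 / 2) * barnes_G (1 + z))"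
proof -
  define F where "F = (\<lambda>n. (1 + z / of_nat (Suc n)) ^ Suc n * exp (- z + z\<^sup>2 / (2 * of_nat (Suc n))))"
  have nz: "1 + z / of_nat (Suc n) \<noteq> 0" for n
  proof
    assume "1 + z / of_nat (Suc n) = 0"
    hence "Re (z / of_nat (Suc n)) = - 1"
      by (metis add_eq_0_iff one_complex.simps(1) uminus_complex.simps(1))
    thus False using Re_scaled_gt_minus_one[OF assms(4), of "Suc n"] by simp
  qed
  note F_lim = barnes_product_nonzero_and_LIMSEQ[OF nz, folded F_def]
  \<comment> \<open>The convergence factors of the Barnes product contribute
    \<open>exp (z\<^sup>2 / 2 * harm N - z * of_nat N)\<close>: the linear part absorbs the
    centering, and the harmonic part meets the power of \<open>N\<close>. At \<open>N = 0\<close>,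
    \<open>powr\<close> has the value 0 and is not an exponential, hence the restriction.\<close>
  have finite_eq: "1 / complex_of_nat N powr (z\<^sup>2 / 2) * (exp (z * of_nat N)
        * (\<Prod>n=1..N. inverse ((1 + z / of_nat n) ^ n)))
      = exp (z\<^sup>2 / 2 * of_real (harm N - ln (real N))) / (\<Prod>n<N. F n)" if "N > 0" for N
  proof -
    have "(\<Prod>n<N. F n) = (\<Prod>n<N. (1 + z / of_nat (Suc n)) ^ Suc n)
        * exp (\<Sum>n<N. - z + z\<^sup>2 / (2 * of_nat (Suc n)))"
      by (simp only: F_def prod.distrib exp_sum finite_lessThan)
    also have "(\<Sum>n<N. - z + z\<^sup>2 / (2 * of_nat (Suc n))) = z\<^sup>2 / 2 * harm N - z * of_nat N"
      unfolding harm_def sum.distrib sum_distrib_left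
      by (simp add: sum.atLeast1_atMost_eq field_simps del: of_nat_Suc)
    also have "(\<Prod>n<N. (1 + z / of_nat (Suc n)) ^ Suc n) = (\<Prod>n=1..N. (1 + z / of_nat n) ^ n)"
      by (simp add: prod.atLeast1_atMost_eq del: of_nat_Suc power_Suc)
    finally have F: "(\<Prod>n<N. F n) = (\<Prod>n=1..N. (1 + z / of_nat n) ^ n)
        * exp (z\<^sup>2 / 2 * harm N - z * of_nat N)" .
    have "complex_of_nat N powr (z\<^sup>2 / 2) = exp (z\<^sup>2 / 2 * of_real (ln (real N)))"
      using that by (simp add: powr_def Ln_of_nat)
    moreover have "of_real (harm N) = (harm N :: complex)"
      by (simp add: harm_def)
    \<comment> \<open>Here \<open>a\<close> stands for \<open>z\<^sup>2 / 2 * ln N\<close>,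
      \<open>b\<close> for \<open>z * N\<close>, \<open>c\<close> for
      \<open>z\<^sup>2 / 2 * harm N\<close>, and \<open>p\<close> for the finite product.\<close>
    moreover have "1 / exp a * (exp b * inverse p) = exp (c - a) / (p * exp (c - b))"
      for a b c p :: complex
      by (simp add: exp_diff divide_inverse)
    moreover have "(\<Prod>n=1..N. inverse ((1 + z / of_nat n) ^ n))
        = inverse (\<Prod>n=1..N. (1 + z / of_nat n) ^ n)"
      using prod_inversef[of "\<lambda>n. (1 + z / of_nat n) ^ n" "{1..N}"] by (simp only: comp_def)
    ultimately show ?thesis
      unfolding F by (simp only: of_real_diff right_diff_distrib)
  qed
  have "(\<lambda>N. exp (z\<^sup>2 / 2 * of_real (harm N - ln (real N))) / (\<Prod>n<N. F n))
      \<longlonglongrightarrow> exp (z\<^sup>2 / 2 * euler_mascheroni) / prodinf F"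
    \<comment> \<open>\<open>F_lim\<close> supplies both the limit of the denominator and its
      nonvanishing.\<close>
    using F_lim by (intro tendsto_intros euler_mascheroni_LIMSEQ_of_real)
  moreover have "\<forall>\<^sub>F N in sequentially. exp (z\<^sup>2 / 2 * of_real (harm N - ln (real N))) / (\<Prod>n<N. F n)
      = 1 / complex_of_nat N powr (z\<^sup>2 / 2) * (exp (z * of_nat N)
        * (\<Prod>n=1..N. inverse ((1 + z / of_nat n) ^ n)))"
    using eventually_gt_at_top[of 0] by eventually_elim (rule finite_eq [symmetric])
  ultimately have lim: "(\<lambda>N. 1 / complex_of_nat N powr (z\<^sup>2 / 2) * (exp (z * of_nat N)
        * (\<Prod>n=1..N. inverse ((1 + z / of_nat n) ^ n))))
      \<longlonglongrightarrow> exp (z\<^sup>2 / 2 * euler_mascheroni) / prodinf F"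
    by (rule Lim_transform_eventually)
  \<comment> \<open>The logarithm of the base \<open>A\<close> is
    \<open>(1 - ln (2 * pi)) / 2\<close>, so \<open>A powr z\<close> cancels the power of
    \<open>2 * pi\<close> in \<open>barnes_G\<close> and leaves \<open>exp (z / 2)\<close>.\<close>
  have sqrt_powr: "complex_of_real (sqrt (exp 1 / (2 * pi))) powr z
      * complex_of_real (2 * pi) powr (z / 2) = exp (z / 2)"
  proof -
    have "ln (sqrt (exp 1 / (2 * pi))) = (1 - ln (2 * pi)) / 2"
      by (simp add: ln_sqrt ln_div)
    moreover have "complex_of_real (sqrt (exp 1 / (2 * pi))) powr z
        = exp (z * of_real (ln (sqrt (exp 1 / (2 * pi)))))"
      by (simp add: powr_def Ln_of_real)
    ultimately have "complex_of_real (sqrt (exp 1 / (2 * pi))) powr z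
        = exp (z * of_real ((1 - ln (2 * pi)) / 2))"
      by (simp only:)
    moreover have "complex_of_real (2 * pi) powr (z / 2) = exp (z / 2 * of_real (ln (2 * pi)))"
      by (simp add: powr_def Ln_of_real del: of_real_mult)
    ultimately show ?thesis
      by (simp add: exp_add [symmetric] algebra_simps diff_divide_distrib)
  qed
  have "complex_of_real (sqrt (exp 1 / (2 * pi))) powr z * exp (z\<^sup>2 / 2) * barnes_G (1 + z)
      = (complex_of_real (sqrt (exp 1 / (2 * pi))) powr z * complex_of_real (2 * pi) powr (z / 2))
        * exp (z\<^sup>2 / 2) * exp (- ((1 + euler_mascheroni) * z\<^sup>2 + z) / 2) * prodinf F"
    by (simp add: barnes_G_def Let_def F_def)
  also have "\<dots> = exp (z / 2 + z\<^sup>2 / 2 + - ((1 + euler_mascheroni) * z\<^sup>2 + z) / 2) * prodinf F"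
    by (simp only: sqrt_powr exp_add)
  \<comment> \<open>The normalisation cancels every term of the Barnes exponent except the one with
    Euler's constant, which matches the limit of \<open>harm N - ln N\<close>.\<close>
  also have "z / 2 + z\<^sup>2 / 2 + - ((1 + euler_mascheroni) * z\<^sup>2 + z) / 2
      = - (z\<^sup>2 / 2 * euler_mascheroni)"
    by (simp add: field_simps)
  finally have "complex_of_real (sqrt (exp 1 / (2 * pi))) powr z * exp (z\<^sup>2 / 2) * barnes_G (1 + z)
      = exp (- (z\<^sup>2 / 2 * euler_mascheroni)) * prodinf F" .
  hence "inverse (complex_of_real (sqrt (exp 1 / (2 * pi))) powr z * exp (z\<^sup>2 / 2)
      * barnes_G (1 + z)) = inverse (exp (- (z\<^sup>2 / 2 * euler_mascheroni)) * prodinf F)"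
    by (rule arg_cong)
  also have "\<dots> = exp (z\<^sup>2 / 2 * euler_mascheroni) / prodinf F"
    by (simp only: exp_minus inverse_mult_distrib inverse_inverse_eq divide_inverse)
  finally have "inverse (complex_of_real (sqrt (exp 1 / (2 * pi))) powr z * exp (z\<^sup>2 / 2)
      * barnes_G (1 + z)) = exp (z\<^sup>2 / 2 * euler_mascheroni) / prodinf F" .
  with lim show ?thesis
    by (simp only: expectation_exp_gamma_sum[OF assms])
qed

end
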